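(* Let $H$ and $K$ be cancellative commutative semigroups. Every isomorphism $f \colon \mathcal P(H) \to \mathcal P(K)$ maps $\mathcal P_{\mathrm{fin}}(H)$ bijectively onto $\mathcal P_{\mathrm{fin}}(K)$, that is, restricts to an isomorphism $\mathcal P_{\mathrm{fin}}(H) \to \mathcal P_{\mathrm{fin}}(K)$.
   Context: Semigroups are written multiplicatively. A semigroup is cancellative if for each element $a$ both maps $x \mapsto xa$ and $x \mapsto ax$ are injective. For a semigroup $H$, $\mathcal P(H)$ denotes the family of all non-empty subsets (finite or infinite) of $H$, which is a semigroup under setwise multiplication $XY := \{xy : x\in X,\ y\in Y\}$; $\mathcal P_{\mathrm{fin}}(H)$ denotes the subsemigroup of $\mathcal P(H)$ consisting of the non-empty finite subsets of $H$. An isomorphism is a bijective semigroup homomorphism. *)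

theory Defs
  imports "HOL-Algebra.Coset"
begin

text \<open>
  HOL-Algebra has no record of bare semigroups, so a semigroup is represented by a
  \<open>monoid\<close> record whose field \<open>one\<close> is left unconstrained: no axiom below mentions it, and
  neither do the library's \<^const>\<open>hom\<close> and \<^const>\<open>iso\<close>, which are therefore exactly
  semigroup homomorphisms and bijective semigroup homomorphisms.
\<close>

locale mult_semigroup =
  fixes H (structure)
  assumes mult_closed: "\<lbrakk>x \<in> carrier H; y \<in> carrier H\<rbrakk> \<Longrightarrow> x \<otimes> y \<in> carrier H"
    and mult_assoc: "\<lbrakk>x \<in> carrier H; y \<in> carrier H; z \<in> carrier H\<rbrakk>
      \<Longrightarrow> (x \<otimes> y) \<otimes> z = x \<otimes> (y \<otimes> z)"

locale comm_mult_semigroup = mult_semigroup +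
  assumes mult_comm: "\<lbrakk>x \<in> carrier H; y \<in> carrier H\<rbrakk> \<Longrightarrow> x \<otimes> y = y \<otimes> x"

locale cancel_mult_semigroup = mult_semigroup +
  assumes inj_mult_right: "a \<in> carrier H \<Longrightarrow> inj_on (\<lambda>x. x \<otimes> a) (carrier H)"
    and inj_mult_left: "a \<in> carrier H \<Longrightarrow> inj_on (\<lambda>x. a \<otimes> x) (carrier H)"

locale cancel_comm_mult_semigroup = cancel_mult_semigroup + comm_mult_semigroup

text \<open>
  The operation is the library's setwise product \<^const>\<open>set_mult\<close>. The value of \<open>one\<close> only
  fills the record field.
\<close>

definition power_semigroup :: "('a, 'm) monoid_scheme \<Rightarrow> 'a set monoid"
  where "power_semigroup H =
    \<lparr>carrier = {X. X \<subseteq> carrier H \<and> X \<noteq> {}}, mult = set_mult H, one = {\<one>\<^bsub>H\<^esub>}\<rparr>"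

definition fin_power_semigroup :: "('a, 'm) monoid_scheme \<Rightarrow> 'a set monoid"
  where "fin_power_semigroup H =
    (power_semigroup H)\<lparr>carrier := {X \<in> carrier (power_semigroup H). finite X}\<rparr>"

lemma (in mult_semigroup) mult_semigroup_power_semigroup:
  "mult_semigroup (power_semigroup H)"
proof
  fix X Y Z
  assume "X \<in> carrier (power_semigroup H)" "Y \<in> carrier (power_semigroup H)"
  then show "X \<otimes>\<^bsub>power_semigroup H\<^esub> Y \<in> carrier (power_semigroup H)"
    by (auto simp: power_semigroup_def set_mult_def intro: mult_closed)
  assume "Z \<in> carrier (power_semigroup H)"
  with \<open>X \<in> _\<close> \<open>Y \<in> _\<close>
  have sub: "X \<subseteq> carrier H" "Y \<subseteq> carrier H" "Z \<subseteq> carrier H"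
    by (auto simp: power_semigroup_def)
  then have "(x \<otimes> y) \<otimes> z = x \<otimes> (y \<otimes> z)" if "x \<in> X" "y \<in> Y" "z \<in> Z" for x y z
    using that by (blast intro: mult_assoc)
  then show "X \<otimes>\<^bsub>power_semigroup H\<^esub> Y \<otimes>\<^bsub>power_semigroup H\<^esub> Z =
      X \<otimes>\<^bsub>power_semigroup H\<^esub> (Y \<otimes>\<^bsub>power_semigroup H\<^esub> Z)"
    by (simp add: power_semigroup_def set_mult_def)
qed

lemma (in mult_semigroup) mult_semigroup_fin_power_semigroup:
  "mult_semigroup (fin_power_semigroup H)"
proof -
  interpret P: mult_semigroup "power_semigroup H"
    by (rule mult_semigroup_power_semigroup)
  have fin: "finite (X \<otimes>\<^bsub>power_semigroup H\<^esub> Y)" if "finite X" "finite Y" for X Y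
    using that by (simp add: power_semigroup_def set_mult_def)
  show ?thesis
    by unfold_locales
      (simp_all add: fin_power_semigroup_def fin P.mult_closed P.mult_assoc)
qed

end

theory Submission
  imports Defs
begin

text \<open>
  Finiteness of a non-empty set \<open>X\<close> can be read off from the multiplication of the power
  semigroup alone: \<open>X\<close> is finite if and only if the equation \<open>X Y = X (X X)\<close> has only finitely
  many solutions \<open>Y\<close>. An isomorphism of power semigroups maps the solutions for \<open>X\<close>
  bijectively onto the solutions for \<open>f X\<close>, so it preserves finiteness in both directions.

  If \<open>X\<close> is finite and \<open>x \<in> X\<close>, each solution \<open>Y\<close> satisfies \<open>x Y \<subseteq> X (X X)\<close>; by cancellation
  \<open>Y\<close> is a subset of one fixed finite set.
  If \<open>X\<close> is infinite, fix \<open>x \<in> X\<close>. For each \<open>y \<in> X\<close> other than \<open>x\<close>, deleting the single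
  element \<open>x y\<close> from \<open>X X\<close> leaves a solution, because every product \<open>u (x y)\<close> with \<open>u \<in> X\<close> can
  be rewritten by commutativity as a product of an element of \<open>X\<close> with an element of \<open>X X\<close> other
  than \<open>x y\<close>. Cancellation makes these infinitely many solutions pairwise different.
\<close>

definition cube_quotients :: "('a, 'm) monoid_scheme \<Rightarrow> 'a set \<Rightarrow> 'a set set"
  where "cube_quotients H X =
    {Y \<in> carrier (power_semigroup H). set_mult H X Y = set_mult H X (set_mult H X X)}"

lemma (in cancel_mult_semigroup) finite_cube_quotients:
  assumes "X \<in> carrier (power_semigroup H)" and "finite X"
  shows "finite (cube_quotients H X)"
proof -
  from assms(1) obtain x where x: "x \<in> X" "x \<in> carrier H"
    by (auto simp: power_semigroup_def)
  let ?Q = "(\<lambda>y. x \<otimes> y) -` (X <#> (X <#> X)) \<inter> carrier H"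
  have "finite (X <#> (X <#> X))"
    using assms(2) by (simp add: set_mult_def)
  then have "finite ?Q"
    by (rule finite_vimage_IntI[OF _ inj_mult_left[OF x(2)]])
  moreover have "Y \<subseteq> ?Q" if Y: "Y \<in> cube_quotients H X" for Y
  proof
    fix y assume y: "y \<in> Y"
    then have "x \<otimes> y \<in> X <#> Y" using x(1) by (auto simp: set_mult_def)
    with y Y show "y \<in> ?Q" by (auto simp: cube_quotients_def power_semigroup_def)
  qed
  then have "cube_quotients H X \<subseteq> Pow ?Q" by blast
  ultimately show ?thesis
    by (meson finite_Pow_iff finite_subset)
qed

text \<open>
  The deleted element is recovered by swapping factors: \<open>u (x y) = x (u y)\<close> avoids \<open>x y\<close> when
  \<open>u \<noteq> x\<close>, and \<open>x (x y) = y (x x)\<close> avoids it in the remaining case.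
\<close>

lemma (in cancel_comm_mult_semigroup) square_minus_product_in_cube_quotients:
  assumes X: "X \<subseteq> carrier H" and x: "x \<in> X" and y: "y \<in> X" and "x \<noteq> y"
  shows "(X <#> X) - {x \<otimes> y} \<in> cube_quotients H X"
proof -
  have xc: "x \<in> carrier H" and yc: "y \<in> carrier H" using X x y by auto
  have xx: "x \<otimes> x \<in> (X <#> X) - {x \<otimes> y}"
    using x inj_onD[OF inj_mult_left[OF xc] _ xc yc] \<open>x \<noteq> y\<close> by (auto simp: set_mult_def)
  have "u \<otimes> w \<in> X <#> ((X <#> X) - {x \<otimes> y})" if u: "u \<in> X" and w: "w \<in> X <#> X" for u w
  proof (cases "w = x \<otimes> y")
    case False
    with u w show ?thesis by (auto simp: set_mult_def)
  next
    case True
    have uc: "u \<in> carrier H" using X u by auto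
    have swap: "u \<otimes> (x \<otimes> y) = x \<otimes> (u \<otimes> y)"
      using mult_assoc[OF uc xc yc] mult_assoc[OF xc uc yc] mult_comm[OF uc xc] by simp
    show ?thesis
    proof (cases "u = x")
      case False
      have "u \<otimes> y \<noteq> x \<otimes> y"
        using inj_onD[OF inj_mult_right[OF yc] _ uc xc] False by auto
      then have "u \<otimes> y \<in> (X <#> X) - {x \<otimes> y}"
        using u y by (auto simp: set_mult_def)
      with x show ?thesis unfolding True swap by (force simp: set_mult_def)
    next
      case u_eq: True
      have "x \<otimes> (x \<otimes> y) = y \<otimes> (x \<otimes> x)"
        using mult_assoc[OF xc xc yc] mult_comm[OF mult_closed[OF xc xc] yc] by simp
      with xx y show ?thesis unfolding True u_eq by (force simp: set_mult_def)
    qed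
  qed
  then have "X <#> (X <#> X) \<subseteq> X <#> ((X <#> X) - {x \<otimes> y})"
    by (auto simp: set_mult_def[of H X "X <#> X"])
  moreover have "X <#> ((X <#> X) - {x \<otimes> y}) \<subseteq> X <#> (X <#> X)"
    by (auto simp: set_mult_def)
  moreover have "X <#> X \<subseteq> carrier H"
    using X by (auto simp: set_mult_def intro!: mult_closed)
  ultimately show ?thesis
    using xx by (auto simp: cube_quotients_def power_semigroup_def)
qed

lemma (in cancel_comm_mult_semigroup) infinite_cube_quotients:
  assumes X: "X \<subseteq> carrier H" and inf: "infinite X"
  shows "infinite (cube_quotients H X)"
proof -
  obtain x where x: "x \<in> X" using inf by (metis finite.emptyI ex_in_conv)
  let ?del = "\<lambda>y. (X <#> X) - {x \<otimes> y}"
  have "inj_on ?del (X - {x})"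
  proof (rule inj_onI)
    fix y z
    assume yz: "y \<in> X - {x}" "z \<in> X - {x}" and eq: "?del y = ?del z"
    have "x \<otimes> y \<in> X <#> X" "x \<otimes> z \<in> X <#> X"
      using x yz by (auto simp: set_mult_def)
    moreover have "x \<otimes> y \<notin> ?del z" unfolding eq[symmetric] by simp
    ultimately have "x \<otimes> y = x \<otimes> z" by simp
    moreover have "x \<in> carrier H" "y \<in> carrier H" "z \<in> carrier H" using X x yz by auto
    ultimately show "y = z" by (simp add: inj_on_eq_iff[OF inj_mult_left])
  qed
  moreover have "?del ` (X - {x}) \<subseteq> cube_quotients H X"
    using square_minus_product_in_cube_quotients[OF X x] by blast
  moreover have "infinite (X - {x})" using inf by simp
  ultimately show ?thesis
    by (meson finite_imageD finite_subset)
qed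

lemma finite_iff_finite_cube_quotients:
  assumes "cancel_comm_mult_semigroup H" and "X \<in> carrier (power_semigroup H)"
  shows "finite X \<longleftrightarrow> finite (cube_quotients H X)"
proof -
  interpret cancel_comm_mult_semigroup H by fact
  have "X \<subseteq> carrier H" using assms(2) by (simp add: power_semigroup_def)
  then show ?thesis
    using finite_cube_quotients infinite_cube_quotients assms(2) by blast
qed

lemma iso_image_cube_quotients:
  assumes "mult_semigroup H"
    and f: "f \<in> iso (power_semigroup H) (power_semigroup K)"
    and X: "X \<in> carrier (power_semigroup H)"
  shows "f ` cube_quotients H X = cube_quotients K (f X)"
proof -
  let ?P = "carrier (power_semigroup H)"
  interpret P: mult_semigroup "power_semigroup H"
    by (rule mult_semigroup.mult_semigroup_power_semigroup) fact
  have closed: "set_mult H A B \<in> ?P" if "A \<in> ?P" "B \<in> ?P" for A B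
    using P.mult_closed[OF that] by (simp add: power_semigroup_def)
  have hom: "f (set_mult H A B) = set_mult K (f A) (f B)" if "A \<in> ?P" "B \<in> ?P" for A B
    using f that by (auto simp: iso_def hom_def power_semigroup_def)
  have inj: "inj_on f ?P" and im: "f ` ?P = carrier (power_semigroup K)"
    using f by (auto simp: iso_def bij_betw_def)
  have solution_iff:
    "set_mult K (f X) (f Y) = set_mult K (f X) (set_mult K (f X) (f X)) \<longleftrightarrow>
      set_mult H X Y = set_mult H X (set_mult H X X)" if "Y \<in> ?P" for Y
    using inj_on_eq_iff[OF inj closed[OF X that] closed[OF X closed[OF X X]]]
    by (simp add: hom X that closed)
  show ?thesis
    unfolding cube_quotients_def im[symmetric] using solution_iff by auto
qed

theorem theorem2p5:
  fixes H :: "('a, 'm) monoid_scheme" and K :: "('b, 'n) monoid_scheme"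
    and f :: "'a set \<Rightarrow> 'b set"
  assumes "cancel_comm_mult_semigroup H"
    and "cancel_comm_mult_semigroup K"
    and "f \<in> iso (power_semigroup H) (power_semigroup K)"
  shows "f \<in> iso (fin_power_semigroup H) (fin_power_semigroup K)"
proof -
  interpret H: cancel_comm_mult_semigroup H by fact
  let ?P = "carrier (power_semigroup H)"
  have inj: "inj_on f ?P" and im: "f ` ?P = carrier (power_semigroup K)"
    using assms(3) by (auto simp: iso_def bij_betw_def)
  have fin: "finite (f X) \<longleftrightarrow> finite X" if X: "X \<in> ?P" for X
  proof -
    have "inj_on f (cube_quotients H X)"
      using inj by (rule inj_on_subset) (auto simp: cube_quotients_def)
    then have "finite (cube_quotients K (f X)) \<longleftrightarrow> finite (cube_quotients H X)"
      using iso_image_cube_quotients[OF H.mult_semigroup_axioms assms(3) X]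
      by (metis finite_image_iff)
    moreover have "f X \<in> carrier (power_semigroup K)" using X im by blast
    ultimately show ?thesis
      using X by (simp add: finite_iff_finite_cube_quotients[OF assms(1)]
          finite_iff_finite_cube_quotients[OF assms(2)])
  qed
  have "f ` {X \<in> ?P. finite X} = {Y \<in> carrier (power_semigroup K). finite Y}"
    unfolding im[symmetric] using fin by auto
  moreover have "inj_on f {X \<in> ?P. finite X}"
    using inj by (rule inj_on_subset) auto
  moreover have "f \<in> hom (power_semigroup H) (power_semigroup K)"
    using assms(3) by (simp add: iso_def)
  then have "f \<in> hom (fin_power_semigroup H) (fin_power_semigroup K)"
    using fin by (auto simp: hom_def fin_power_semigroup_def Pi_iff)
  ultimately show ?thesis
    by (simp add: iso_def bij_betw_def fin_power_semigroup_def)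
qed

end
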